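(* Let $\mathfrak{f}\in\mathbb{Z}_p[T]$ be a random $p$-adic polynomial of degree $d$ and $x\in\mathbb{Z}_p$. Then for every $\ell\in\{0,\dots,d\}$, $$\mathbb{P}(\mathrm{St}(\mathfrak{f};x,1)=\ell)=\frac{1-p^{-1}}{1-p^{-(d+1)}}\,p^{\ell-d}.$$ In particular, $\mathbb{E}\,\mathrm{St}(\mathfrak{f};x,1)=d+\frac{d+1}{p^{d+1}-1}-\frac1{p-1}$.
   Context: A random $p$-adic polynomial of degree $d$ is $\mathfrak{f}=\sum_{k=0}^d\mathfrak{f}_kT^k$ with the $\mathfrak{f}_k$ independent and Haar-uniformly distributed in $\mathbb{Z}_p$. For nonzero $f=\sum_kf_kT^k\in\mathbb{Q}_p[T]$, $\mathrm{St}(f):=\max\{k\in\mathbb{N}:|f_l|\le|f_k|\text{ for all }l<k\}$ (with $f_k=0$ for $k>\deg f$), where $|\cdot|$ is the $p$-adic absolute value, and $\mathrm{St}(f;x,p^{-s}):=\mathrm{St}(f(x+p^sT))$. *)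

theory Defs
  imports "HOL-Probability.Probability" "HOL-Computational_Algebra.Computational_Algebra"
    "Berlekamp_Zassenhaus.Finite_Field"
begin

text \<open>
  The prime is carried by the type: throughout, \<open>'p\<close> ranges over the types whose cardinality is
  a prime number, and \<open>p = CARD('p)\<close>. Every prime is the cardinality of such a type.

  The ring \<open>\<int>\<^sub>p\<close> is the inverse limit of the rings \<open>\<int>/p\<^sup>n\<int>\<close>: an element is a compatible sequence of
  residues, each represented in \<open>{0..<p\<^sup>n}\<close>.
\<close>

typedef ('p::prime_card) zp =
  "{x :: nat \<Rightarrow> int. \<forall>n. 0 \<le> x n \<and> x n < int CARD('p) ^ n \<and> x (Suc n) mod int CARD('p) ^ n = x n}"
  morphisms residue Abs_zp
  by (rule exI[of _ "\<lambda>_. 0"]) (simp add: prime_gt_0_nat[OF prime_card])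

setup_lifting type_definition_zp

lemma CARD_pos_int: "0 < int CARD('p::prime_card) ^ n"
  by (simp add: prime_gt_0_nat[OF prime_card])

lemma mod_Suc_power_mod: "(a mod int CARD('p::prime_card) ^ Suc n) mod int CARD('p) ^ n
    = a mod int CARD('p) ^ n"
  by (rule mod_mod_cancel) simp

lemma residue_range: "0 \<le> residue (x :: 'p::prime_card zp) n" "residue x n < int CARD('p) ^ n"
  using residue[of x] by auto

lemma residue_mod [simp]: "residue (x :: 'p::prime_card zp) n mod int CARD('p) ^ n = residue x n"
  using residue_range[of x n] by simp

lemma residue_Suc: "residue (x :: 'p::prime_card zp) (Suc n) mod int CARD('p) ^ n = residue x n"
  using residue[of x] by auto

lemma residue_mod_le:
  "m \<le> n \<Longrightarrow> residue (x :: 'p::prime_card zp) n mod int CARD('p) ^ m = residue x m"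
proof (induction n rule: nat_induct_at_least)
  case base
  show ?case by simp
next
  case (Suc n)
  have "residue x (Suc n) mod int CARD('p) ^ m
      = residue x (Suc n) mod int CARD('p) ^ n mod int CARD('p) ^ m"
    using Suc.hyps by (simp add: mod_mod_cancel le_imp_power_dvd)
  then show ?case using Suc.IH by (simp add: residue_Suc)
qed

lemma residue_0 [simp]: "residue (x :: 'p::prime_card zp) 0 = 0"
  using residue_range[of x 0] by simp

instantiation zp :: (prime_card) comm_ring_1
begin

lift_definition zero_zp :: "'a zp" is "\<lambda>_. 0"
  by (simp add: prime_gt_0_nat[OF prime_card])

lift_definition one_zp :: "'a zp" is "\<lambda>n. 1 mod int CARD('a) ^ n"
  using CARD_pos_int[where 'p='a] mod_Suc_power_mod[where 'p='a] by simp

lift_definition plus_zp :: "'a zp \<Rightarrow> 'a zp \<Rightarrow> 'a zp" is "\<lambda>x y n. (x n + y n) mod int CARD('a) ^ n"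
  using CARD_pos_int[where 'p='a] mod_Suc_power_mod[where 'p='a] by simp (metis mod_add_eq)

lift_definition minus_zp :: "'a zp \<Rightarrow> 'a zp \<Rightarrow> 'a zp" is "\<lambda>x y n. (x n - y n) mod int CARD('a) ^ n"
  using CARD_pos_int[where 'p='a] mod_Suc_power_mod[where 'p='a] by simp (metis mod_diff_eq)

lift_definition uminus_zp :: "'a zp \<Rightarrow> 'a zp" is "\<lambda>x n. (- x n) mod int CARD('a) ^ n"
  using CARD_pos_int[where 'p='a] mod_Suc_power_mod[where 'p='a] by simp (metis mod_minus_eq)

lift_definition times_zp :: "'a zp \<Rightarrow> 'a zp \<Rightarrow> 'a zp" is "\<lambda>x y n. (x n * y n) mod int CARD('a) ^ n"
  using CARD_pos_int[where 'p='a] mod_Suc_power_mod[where 'p='a] by simp (metis mod_mult_eq)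

instance
proof
  fix a b c :: "'a zp"
  show "a + b + c = a + (b + c)" by transfer (simp add: mod_simps ac_simps)
  show "a + b = b + a" by transfer (simp add: ac_simps)
  show "0 + a = a" by transfer (simp add: fun_eq_iff)
  show "- a + a = 0" by transfer (simp add: mod_simps)
  show "a - b = a + - b" by transfer (simp add: mod_simps)
  show "a * b * c = a * (b * c)" by transfer (simp add: mod_simps ac_simps)
  show "a * b = b * a" by transfer (simp add: ac_simps)
  show "1 * a = a" by transfer (simp add: mod_simps fun_eq_iff)
  show "(a + b) * c = a * c + b * c" by transfer (simp add: mod_simps algebra_simps)
  have "(1::int) mod int CARD('a) ^ 1 \<noteq> 0"
    using prime_gt_1_nat[OF prime_card[where 'a='a]] by simp
  then show "(0::'a zp) \<noteq> 1" by transfer metis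
qed

end

lemma residue_minus:
  "residue (x - y :: 'p::prime_card zp) n = (residue x n - residue y n) mod int CARD('p) ^ n"
  by (simp add: minus_zp.rep_eq)

lemma residue_times:
  "residue (x * y :: 'p::prime_card zp) n = (residue x n * residue y n) mod int CARD('p) ^ n"
  by (simp add: times_zp.rep_eq)

lemma residue_eq_0_mono: "m \<le> n \<Longrightarrow> residue (x :: 'p::prime_card zp) n = 0 \<Longrightarrow> residue x m = 0"
  using residue_mod_le[of m n x] by simp

lemma zp_eq_0_iff: "x = 0 \<longleftrightarrow> (\<forall>n. residue (x :: 'p::prime_card zp) n = 0)"
  by (simp add: residue_inject[symmetric] zero_zp.rep_eq fun_eq_iff)

text \<open>The exponent of \<open>p\<close> in a nonzero \<open>x\<close>; the value at \<open>0\<close> is irrelevant.\<close>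

definition zp_val :: "'p::prime_card zp \<Rightarrow> nat" where
  "zp_val x = (LEAST n. residue x (Suc n) \<noteq> 0)"

lemma le_zp_val_iff:
  assumes "(x :: 'p::prime_card zp) \<noteq> 0"
  shows "n \<le> zp_val x \<longleftrightarrow> residue x n = 0"
proof -
  obtain k where "residue x k \<noteq> 0" using assms zp_eq_0_iff by blast
  then obtain m where "residue x (Suc m) \<noteq> 0" by (cases k) auto
  then have nz: "residue x (Suc (zp_val x)) \<noteq> 0" unfolding zp_val_def by (rule LeastI)
  have z: "residue x (zp_val x) = 0"
  proof (cases "zp_val x")
    case (Suc j)
    then show ?thesis using not_less_Least[of j "\<lambda>n. residue x (Suc n) \<noteq> 0"]
      by (auto simp: zp_val_def)
  qed simp
  show ?thesis using nz z residue_eq_0_mono[of n "zp_val x" x]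
      residue_eq_0_mono[of "Suc (zp_val x)" n x] by linarith
qed

lemma residue_times_neq_0:
  assumes "(x :: 'p::prime_card zp) \<noteq> 0" "y \<noteq> 0"
  shows "residue (x * y) n = 0 \<longleftrightarrow> n \<le> zp_val x + zp_val y"
proof -
  define p where "p = int CARD('p)"
  have p: "prime p" using prime_card_int[where 'a='p] by (simp add: p_def)
  define N where "N = Suc (n + zp_val x + zp_val y)"
  have dvd: "p ^ k dvd residue z N \<longleftrightarrow> residue z k = 0" if "k \<le> N" for k and z :: "'p zp"
    using residue_mod_le[OF that, of z] by (simp add: p_def dvd_eq_mod_eq_0)
  have mult: "residue z N \<noteq> 0 \<and> multiplicity p (residue z N) = zp_val z"
    if "z \<noteq> 0" "zp_val z < N" for z :: "'p zp"
  proof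
    show nz: "residue z N \<noteq> 0" using le_zp_val_iff[OF that(1), of N] that(2) by auto
    show "multiplicity p (residue z N) = zp_val z"
      by (rule multiplicity_eqI)
        (use dvd[of "zp_val z" z] dvd[of "Suc (zp_val z)" z] that
          le_zp_val_iff[OF that(1), of "zp_val z"] le_zp_val_iff[OF that(1), of "Suc (zp_val z)"]
         in auto)
  qed
  have x: "residue x N \<noteq> 0" "multiplicity p (residue x N) = zp_val x"
    and y: "residue y N \<noteq> 0" "multiplicity p (residue y N) = zp_val y"
    using mult assms by (auto simp: N_def)
  have "residue (x * y) n = 0 \<longleftrightarrow> p ^ n dvd residue (x * y) N"
    using dvd[of n "x * y"] by (simp add: N_def)
  also have "\<dots> \<longleftrightarrow> p ^ n dvd residue x N * residue y N"
    by (simp add: residue_times p_def dvd_mod_iff le_imp_power_dvd N_def)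
  also have "\<dots> \<longleftrightarrow> n \<le> multiplicity p (residue x N * residue y N)"
    using x y p by (intro power_dvd_iff_le_multiplicity) (auto simp: not_prime_unit)
  also have "multiplicity p (residue x N * residue y N) = zp_val x + zp_val y"
    using x y p by (subst prime_elem_multiplicity_mult_distrib) auto
  finally show ?thesis .
qed

instance zp :: (prime_card) idom
proof
  fix x y :: "'a zp"
  assume "x \<noteq> 0" "y \<noteq> 0"
  then have "residue (x * y) (Suc (zp_val x + zp_val y)) \<noteq> 0"
    using residue_times_neq_0 by (metis not_less_eq_eq order_refl)
  then show "x * y \<noteq> 0" by (auto simp: zero_zp.rep_eq)
qed

definition zp_abs :: "'p::prime_card zp \<Rightarrow> real" where
  "zp_abs x = (if x = 0 then 0 else (1 / real CARD('p)) ^ zp_val x)"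

lemma zp_abs_nonneg: "0 \<le> zp_abs x"
  by (simp add: zp_abs_def)

lemma zp_abs_eq_0_iff [simp]: "zp_abs x = 0 \<longleftrightarrow> x = 0"
  by (simp add: zp_abs_def)

lemma zp_abs_le_iff: "zp_abs (x :: 'p::prime_card zp) \<le> (1 / real CARD('p)) ^ n \<longleftrightarrow> residue x n = 0"
proof (cases "x = 0")
  case False
  have "(1 / real CARD('p)) < 1" "0 < 1 / real CARD('p)"
    using prime_gt_1_nat[OF prime_card[where 'a='p]] by auto
  then show ?thesis using False le_zp_val_iff[of x n]
    by (simp add: zp_abs_def power_decreasing_iff del: power_one_over)
qed (simp add: zp_abs_def zero_zp.rep_eq)

lemma zp_abs_times: "zp_abs (x * y :: 'p::prime_card zp) = zp_abs x * zp_abs y"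
proof (cases "x = 0 \<or> y = 0")
  case False
  then have xy: "x * y \<noteq> 0" by simp
  have "n \<le> zp_val (x * y) \<longleftrightarrow> n \<le> zp_val x + zp_val y" for n
    using le_zp_val_iff[OF xy] residue_times_neq_0 False by blast
  then have "zp_val (x * y) = zp_val x + zp_val y" by (meson order_antisym order_refl)
  then show ?thesis using False by (simp add: zp_abs_def power_add)
qed (auto simp: zp_abs_def)

lemma zp_abs_diff_le_max: "zp_abs (x - y :: 'p::prime_card zp) \<le> max (zp_abs x) (zp_abs y)"
proof (cases "x = 0 \<and> y = 0")
  case False
  define z where "z = (if zp_abs x \<le> zp_abs y then y else x)"
  have z: "max (zp_abs x) (zp_abs y) = zp_abs z" by (simp add: z_def max_def)
  have "z \<noteq> 0"
  proof
    assume "z = 0"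
    then have "max (zp_abs x) (zp_abs y) = 0" using z by simp
    then have "zp_abs x \<le> 0" "zp_abs y \<le> 0" by linarith+
    then show False using False zp_abs_nonneg[of x] zp_abs_nonneg[of y]
      by (metis order_antisym zp_abs_eq_0_iff)
  qed
  then have n: "max (zp_abs x) (zp_abs y) = (1 / real CARD('p)) ^ zp_val z" (is "_ = _ ^ ?n")
    using z by (simp only: zp_abs_def if_False)
  define n where "n = ?n"
  have "zp_abs x \<le> (1 / real CARD('p)) ^ n" "zp_abs y \<le> (1 / real CARD('p)) ^ n"
    by (simp_all only: n_def max.cobounded1 max.cobounded2 flip: n)
  then have "residue x n = 0" "residue y n = 0"
    by (simp_all only: zp_abs_le_iff)
  then have "residue (x - y) n = 0" by (simp add: residue_minus)
  then show ?thesis by (simp only: zp_abs_le_iff n flip: n_def)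
qed simp

text \<open>The \<open>p\<close>-adic topology, and with it the Borel sets of \<open>\<int>\<^sub>p\<close>, comes from this metric.\<close>

instantiation zp :: (prime_card) metric_space
begin

definition dist_zp :: "'a zp \<Rightarrow> 'a zp \<Rightarrow> real" where
  "dist_zp x y = zp_abs (x - y)"

definition uniformity_zp :: "('a zp \<times> 'a zp) filter" where
  "uniformity_zp = (INF e\<in>{0<..}. principal {(x, y). dist x y < e})"

definition open_zp :: "'a zp set \<Rightarrow> bool" where
  "open_zp U \<longleftrightarrow> (\<forall>x\<in>U. \<forall>\<^sub>F (x', y) in uniformity. x' = x \<longrightarrow> y \<in> U)"

instance
proof
  fix x y z :: "'a zp"
  show "dist x y = 0 \<longleftrightarrow> x = y" by (simp add: dist_zp_def)
  have "zp_abs (x - y) \<le> max (zp_abs (x - z)) (zp_abs (y - z))"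
    using zp_abs_diff_le_max[of "x - z" "y - z"] by simp
  then show "dist x y \<le> dist x z + dist y z"
    using zp_abs_nonneg[of "x - z"] zp_abs_nonneg[of "y - z"] by (simp add: dist_zp_def)
qed (simp_all add: uniformity_zp_def open_zp_def)

end

text \<open>The field \<open>\<rat>\<^sub>p\<close> is the field of fractions of \<open>\<int>\<^sub>p\<close>, embedded by \<^const>\<open>to_fract\<close>.\<close>

type_synonym 'p qp = "'p zp fract"

definition padic_abs :: "'p::prime_card qp \<Rightarrow> real" where
  "padic_abs q = (THE r. \<exists>a b. b \<noteq> 0 \<and> q = Fract a b \<and> r = zp_abs a / zp_abs b)"

lemma padic_abs_Fract:
  fixes a b :: "'p::prime_card zp"
  assumes "b \<noteq> 0"
  shows "padic_abs (Fract a b) = zp_abs a / zp_abs b"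
  unfolding padic_abs_def
proof (rule the_equality)
  show "\<exists>a' b'. b' \<noteq> 0 \<and> Fract a b = Fract a' b' \<and> zp_abs a / zp_abs b = zp_abs a' / zp_abs b'"
    using assms by blast
next
  fix r
  assume "\<exists>a' b'. b' \<noteq> 0 \<and> Fract a b = Fract a' b' \<and> r = zp_abs a' / zp_abs b'"
  then obtain a' b' where *: "b' \<noteq> 0" "a * b' = a' * b" "r = zp_abs a' / zp_abs b'"
    using assms by (auto simp: eq_fract)
  then have "zp_abs a * zp_abs b' = zp_abs a' * zp_abs b"
    by (simp flip: zp_abs_times)
  then show "r = zp_abs a / zp_abs b"
    using * assms by (simp add: frac_eq_eq)
qed

lemma padic_abs_to_fract: "padic_abs (to_fract x) = zp_abs (x :: 'p::prime_card zp)"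
proof -
  have "zp_abs (1 :: 'p zp) = 1" using zp_abs_times[of "1 :: 'p zp" 1] by simp
  then show ?thesis by (simp add: to_fract_def padic_abs_Fract)
qed

text \<open>
  For \<open>f \<noteq> 0\<close> the set below is finite and contains \<open>0\<close>. For \<open>f = 0\<close> it is all of \<open>\<nat>\<close>, and
  \<open>St 0\<close> is an unspecified number.
\<close>

definition St :: "'p::prime_card qp poly \<Rightarrow> nat" where
  "St f = Max {k. \<forall>l<k. padic_abs (poly.coeff f l) \<le> padic_abs (poly.coeff f k)}"

text \<open>\<open>St_disc f x s\<close> is \<open>St(f; x, p\<^bsup>-s\<^esup>) = St(f(x + p\<^sup>s T))\<close>.\<close>

definition St_disc :: "'p::prime_card qp poly \<Rightarrow> 'p qp \<Rightarrow> int \<Rightarrow> nat" where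
  "St_disc f x s = St (pcompose f [:x, of_nat CARD('p) powi s:])"

text \<open>The Haar probability measure of the compact group \<open>(\<int>\<^sub>p, +)\<close>.\<close>

definition haar_zp :: "'p::prime_card zp measure \<Rightarrow> bool" where
  "haar_zp \<mu> \<longleftrightarrow> prob_space \<mu> \<and> sets \<mu> = sets borel \<and> (\<forall>a. distr \<mu> borel (\<lambda>x. a + x) = \<mu>)"

text \<open>
  \<open>f\<close> is a random \<open>p\<close>-adic polynomial of degree \<open>d\<close> on the probability space \<open>M\<close>. The number \<open>d\<close> is
  the nominal degree: the leading coefficient may vanish.
\<close>

definition random_padic_poly ::
  "'w measure \<Rightarrow> nat \<Rightarrow> ('w \<Rightarrow> 'p::prime_card zp poly) \<Rightarrow> bool" where
  "random_padic_poly M d f \<longleftrightarrow> prob_space M \<and>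
    (\<exists>X :: nat \<Rightarrow> 'w \<Rightarrow> 'p zp.
      prob_space.indep_vars M (\<lambda>_. borel) X {..d} \<and>
      (\<forall>k\<le>d. haar_zp (distr M borel (X k))) \<and>
      (\<forall>\<omega>\<in>space M. f \<omega> = (\<Sum>k\<le>d. Polynomial.monom (X k \<omega>) k)))"

end

theory Submission
  imports Defs "Subresultants.More_Homomorphisms"
begin

text \<open>
  \<open>St f\<close> is the last index at which the absolute value of the coefficients is maximal. Substituting
  \<open>x + T\<close> for \<open>T\<close>, with \<open>x\<close> integral, acts on the coefficients by a unipotent upper triangular
  matrix over \<open>\<int>\<^sub>p\<close> and so does not move this index. Hence only the independent coefficients
  themselves matter: the event that the last maximum is at \<open>l\<close> and has absolute value \<open>p\<^bsup>-n\<^esup>\<close> is a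
  product event of probability \<open>p\<^bsup>-nl\<^esup> (p\<^bsup>-n\<^esup> - p\<^bsup>-(n+1)\<^esup>) p\<^bsup>-(n+1)(d-l)\<^esup>\<close>, and summing over
  \<open>n\<close> gives a geometric series.
\<close>

section \<open>Translation of a polynomial\<close>

text \<open>Coefficient j of h(x + T) is a combination of the coefficients of h of index at least j;
  the assumptions say that \<open>I\<close> is an ideal. The induction uses Horner's form: for h = a
  + T q the translate is a + (x + T) Q, where Q = q(x + T).\<close>

lemma coeff_pcompose_translate_mem:
  fixes h :: "'a::comm_ring_1 poly"
  assumes I: "0 \<in> I" "\<And>a b. a \<in> I \<Longrightarrow> b \<in> I \<Longrightarrow> a + b \<in> I" "\<And>r a. a \<in> I \<Longrightarrow> r * a \<in> I"
    and "\<And>j. k \<le> j \<Longrightarrow> poly.coeff h j \<in> I" "k \<le> j"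
  shows "poly.coeff (h \<circ>\<^sub>p [:x, 1:]) j \<in> I"
  using assms(4,5)
proof (induction h arbitrary: k j)
  case 0
  then show ?case using I(1) by simp
next
  case (pCons a q)
  let ?Q = "q \<circ>\<^sub>p [:x, 1:]"
  \<comment> \<open>Passing from h to q lowers indices by one. Truncated subtraction also covers k =
    0, where every coefficient of q lies in \<open>I\<close>.\<close>
  have q: "poly.coeff q i \<in> I" if "k - 1 \<le> i" for i
    using pCons.prems(1)[of "Suc i"] that by simp
  have Q: "poly.coeff ?Q i \<in> I" if "k - 1 \<le> i" for i
    by (rule pCons.IH[OF q that])
  show ?case
  proof (cases j)
    case 0
    then have "a \<in> I" "x * poly.coeff ?Q 0 \<in> I"
      using pCons.prems(1)[of 0] pCons.prems(2) Q[of 0] I(3) by auto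
    then show ?thesis using 0 I(2) by (simp add: pcompose_pCons)
  next
    case (Suc i)
    then have "poly.coeff ?Q i \<in> I" "x * poly.coeff ?Q (Suc i) \<in> I"
      using pCons.prems(2) Q[of i] Q[of "Suc i"] I(3) by auto
    then show ?thesis using Suc I(2) by (simp add: pcompose_pCons)
  qed
qed

text \<open>The diagonal entries of the translation matrix are 1, so coefficient k changes only by a
  combination of the coefficients of higher index.\<close>

lemma coeff_pcompose_translate_diff_mem:
  fixes h :: "'a::comm_ring_1 poly"
  assumes I: "0 \<in> I" "\<And>a b. a \<in> I \<Longrightarrow> b \<in> I \<Longrightarrow> a + b \<in> I" "\<And>r a. a \<in> I \<Longrightarrow> r * a \<in> I"
    and "\<And>j. k < j \<Longrightarrow> poly.coeff h j \<in> I"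
  shows "poly.coeff (h \<circ>\<^sub>p [:x, 1:]) k - poly.coeff h k \<in> I"
  using assms(4)
proof (induction h arbitrary: k)
  case 0
  then show ?case using I(1) by simp
next
  case (pCons a q)
  let ?Q = "q \<circ>\<^sub>p [:x, 1:]"
  have q: "poly.coeff q i \<in> I" if "k \<le> i" for i
    using pCons.prems[of "Suc i"] that by simp
  have Q: "poly.coeff ?Q k \<in> I"
    by (rule coeff_pcompose_translate_mem[OF I q order_refl])
  show ?case
  proof (cases k)
    case 0
    then show ?thesis using Q I(3)[of "poly.coeff ?Q 0" x] by (simp add: pcompose_pCons)
  next
    case (Suc i)
    have "poly.coeff ?Q i - poly.coeff q i \<in> I"
      using Suc by (intro pCons.IH q) simp
    then have "x * poly.coeff ?Q k + (poly.coeff ?Q i - poly.coeff q i) \<in> I"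
      using Q I by blast
    then show ?thesis using Suc by (simp add: pcompose_pCons algebra_simps)
  qed
qed

section \<open>The index of the last coefficient of maximal absolute value\<close>

lemma zp_abs_0 [simp]: "zp_abs 0 = 0"
  by simp

lemma zp_abs_le_1: "zp_abs (x :: 'p::prime_card zp) \<le> 1"
  using zp_abs_le_iff[of x 0] by simp

lemma zp_abs_uminus: "zp_abs (- x :: 'p::prime_card zp) = zp_abs x"
proof (rule antisym)
  show "zp_abs (- x) \<le> zp_abs x" for x :: "'p zp"
    using zp_abs_diff_le_max[of 0 x] zp_abs_nonneg[of x] by simp
  from this[of "- x"] show "zp_abs x \<le> zp_abs (- x)" by simp
qed

lemma zp_abs_add_le_max: "zp_abs (x + y :: 'p::prime_card zp) \<le> max (zp_abs x) (zp_abs y)"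
  using zp_abs_diff_le_max[of x "- y"] by (simp add: zp_abs_uminus)

lemma zp_abs_mult_le: "zp_abs (r * x :: 'p::prime_card zp) \<le> zp_abs x"
  using mult_right_mono[OF zp_abs_le_1[of r] zp_abs_nonneg[of x]] by (simp add: zp_abs_times)

text \<open>The nonzero absolute values are powers of 1/p, so being smaller than one of them means
  being at most the next one. This makes strict comparison a congruence condition.\<close>

lemma zp_abs_less_iff:
  fixes x y :: "'p::prime_card zp"
  assumes "y \<noteq> 0"
  shows "zp_abs x < zp_abs y \<longleftrightarrow> residue x (Suc (zp_val y)) = 0"
proof (cases "x = 0")
  case True
  then show ?thesis using assms zp_abs_nonneg[of y]
    by (simp add: zero_zp.rep_eq order_less_le)
next
  case False
  have "(1 / real CARD('p)) < 1" "0 < 1 / real CARD('p)"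
    using prime_gt_1_nat[OF prime_card[where 'a='p]] by auto
  then have "zp_abs x < zp_abs y \<longleftrightarrow> Suc (zp_val y) \<le> zp_val x"
    using False assms by (simp add: zp_abs_def power_strict_decreasing_iff Suc_le_eq del: power_one_over)
  then show ?thesis using le_zp_val_iff[OF False] by simp
qed

lemma zp_abs_le_zp_abs_iff:
  fixes x y :: "'p::prime_card zp"
  assumes "y \<noteq> 0"
  shows "zp_abs x \<le> zp_abs y \<longleftrightarrow> residue x (zp_val y) = 0"
  using zp_abs_le_iff[of x "zp_val y"] assms by (simp add: zp_abs_def)

text \<open>Stated for sequences, so that it applies both to \<open>poly.coeff h\<close> and to a
  family of random coefficients continued by zero.\<close>

definition last_max :: "(nat \<Rightarrow> 'p::prime_card zp) \<Rightarrow> nat \<Rightarrow> bool" where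
  "last_max a m \<longleftrightarrow> a m \<noteq> 0 \<and> (\<forall>k<m. zp_abs (a k) \<le> zp_abs (a m)) \<and>
    (\<forall>k>m. zp_abs (a k) < zp_abs (a m))"

lemma last_max_exists:
  assumes "h \<noteq> 0"
  shows "\<exists>m \<le> degree h. last_max (poly.coeff h) m"
proof -
  let ?v = "\<lambda>k. zp_abs (poly.coeff h k)"
  define A where "A = {k \<in> {..degree h}. \<forall>j \<le> degree h. ?v j \<le> ?v k}"
  have "finite (?v ` {..degree h})" "?v ` {..degree h} \<noteq> {}" by auto
  then have "Max (?v ` {..degree h}) \<in> ?v ` {..degree h}" by (rule Max_in)
  then obtain k0 where k0: "k0 \<le> degree h" "?v k0 = Max (?v ` {..degree h})"
    by (metis (no_types, lifting) imageE atMost_iff)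
  have "finite A" by (simp add: A_def)
  moreover have "k0 \<in> A" using k0 Max_ge[OF \<open>finite (?v ` {..degree h})\<close>] by (auto simp: A_def)
  ultimately have M: "Max A \<in> A" "\<And>k. k \<in> A \<Longrightarrow> k \<le> Max A" by (auto intro: Max_in)
  \<comment> \<open>The leading coefficient is nonzero, so the maximum is positive and strictly
    exceeds the zero coefficients beyond the degree.\<close>
  have "?v (degree h) \<le> ?v (Max A)" using M(1) by (auto simp: A_def)
  moreover have "0 < ?v (degree h)" using assms zp_abs_nonneg[of "poly.coeff h (degree h)"]
    by (simp add: order_less_le)
  ultimately have pos: "0 < ?v (Max A)" by linarith
  have "last_max (poly.coeff h) (Max A)"
    unfolding last_max_def
  proof (intro conjI allI impI)
    show "poly.coeff h (Max A) \<noteq> 0" using pos by (auto simp: zp_abs_def)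
    fix k assume "k < Max A"
    then show "?v k \<le> ?v (Max A)" using M(1) by (auto simp: A_def)
  next
    fix k assume k: "Max A < k"
    show "?v k < ?v (Max A)"
    proof (cases "k \<le> degree h")
      case True
      have "k \<notin> A" using k M(2)[of k] by auto
      then obtain j where j: "j \<le> degree h" "?v k < ?v j"
        using True by (auto simp: A_def not_le)
      moreover have "?v j \<le> ?v (Max A)" using M(1) j by (auto simp: A_def)
      ultimately show ?thesis by linarith
    next
      case False
      then have "poly.coeff h k = 0" by (simp add: coeff_eq_0)
      then show ?thesis using pos by (simp add: zp_abs_def)
    qed
  qed
  then show ?thesis using M(1) by (auto simp: A_def)
qed

text \<open>The set in \<open>St\<close> collects the indices whose coefficient is at least as large
  as all earlier ones. The last maximum m is such an index, and m itself disqualifies every later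
  one.\<close>

lemma St_eq_last_max:
  assumes "last_max (poly.coeff h) m"
  shows "St (map_poly to_fract h) = m"
proof -
  have c: "padic_abs (poly.coeff (map_poly to_fract h) k) = zp_abs (poly.coeff h k)" for k
    by (simp add: coeff_map_poly padic_abs_to_fract)
  show ?thesis
    unfolding St_def c
  proof (rule Max_eqI)
    have le: "k \<le> m" if "\<forall>l<k. zp_abs (poly.coeff h l) \<le> zp_abs (poly.coeff h k)" for k
    proof (rule ccontr)
      assume "\<not> k \<le> m"
      then have "zp_abs (poly.coeff h k) < zp_abs (poly.coeff h m)"
        and "zp_abs (poly.coeff h m) \<le> zp_abs (poly.coeff h k)"
        using assms that by (auto simp: last_max_def)
      then show False by linarith
    qed
    then show "finite {k. \<forall>l<k. zp_abs (poly.coeff h l) \<le> zp_abs (poly.coeff h k)}"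
      by (auto intro!: finite_subset[of _ "{..m}"])
    show "k \<le> m" if "k \<in> {k. \<forall>l<k. zp_abs (poly.coeff h l) \<le> zp_abs (poly.coeff h k)}" for k
      using le that by blast
    show "m \<in> {k. \<forall>l<k. zp_abs (poly.coeff h l) \<le> zp_abs (poly.coeff h k)}"
      using assms by (auto simp: last_max_def)
  qed
qed

text \<open>By the ultrametric inequality, the elements of absolute value less than c, and those of
  absolute value at most c, form ideals \<open>I\<close> and \<open>J\<close>. For c the maximal
  absolute value, membership in both survives translation.\<close>

lemma last_max_translate:
  assumes "last_max (poly.coeff h) m"
  shows "last_max (poly.coeff (h \<circ>\<^sub>p [:x, 1:])) m"
proof -
  let ?g = "h \<circ>\<^sub>p [:x, 1:]" and ?c = "zp_abs (poly.coeff h m)"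
  have nz: "poly.coeff h m \<noteq> 0" using assms by (simp add: last_max_def)
  then have pos: "0 < ?c" using zp_abs_nonneg[of "poly.coeff h m"]
    by (simp add: order_less_le)
  define I where "I = {y :: 'a zp. zp_abs y < ?c}"
  define J where "J = {y :: 'a zp. zp_abs y \<le> ?c}"
  have I: "0 \<in> I" "\<And>a b. a \<in> I \<Longrightarrow> b \<in> I \<Longrightarrow> a + b \<in> I" "\<And>r a. a \<in> I \<Longrightarrow> r * a \<in> I"
    using pos by (auto simp: I_def intro: le_less_trans[OF zp_abs_add_le_max] le_less_trans[OF zp_abs_mult_le])
  have J: "0 \<in> J" "\<And>a b. a \<in> J \<Longrightarrow> b \<in> J \<Longrightarrow> a + b \<in> J" "\<And>r a. a \<in> J \<Longrightarrow> r * a \<in> J"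
    using pos by (auto simp: J_def intro: order.trans[OF zp_abs_add_le_max] order.trans[OF zp_abs_mult_le])
  have hI: "poly.coeff h j \<in> I" if "m < j" for j
    using assms that by (simp add: last_max_def I_def)
  have hJ: "poly.coeff h j \<in> J" for j
    using assms by (cases j m rule: linorder_cases) (auto simp: last_max_def J_def)
  have gI: "poly.coeff ?g j \<in> I" if "m < j" for j
    by (rule coeff_pcompose_translate_mem[OF I, where k="Suc m"]) (use hI that in auto)
  have gJ: "poly.coeff ?g j \<in> J" for j
    by (rule coeff_pcompose_translate_mem[OF J, where k=0]) (use hJ in auto)
  have d: "poly.coeff ?g m - poly.coeff h m \<in> I"
    by (rule coeff_pcompose_translate_diff_mem[OF I hI])
  \<comment> \<open>The old coefficient is the new one minus their difference. The difference is
    smaller than c, so the new coefficient must reach c.\<close>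
  have "?c \<le> max (zp_abs (poly.coeff ?g m)) (zp_abs (poly.coeff ?g m - poly.coeff h m))"
    using zp_abs_diff_le_max[of "poly.coeff ?g m" "poly.coeff ?g m - poly.coeff h m"] by simp
  then have "?c \<le> zp_abs (poly.coeff ?g m)" using d by (auto simp: I_def)
  then have eq: "zp_abs (poly.coeff ?g m) = ?c" using gJ[of m] by (auto simp: J_def)
  then have "poly.coeff ?g m \<noteq> 0" using pos by (auto simp: zp_abs_def)
  then show ?thesis using gI gJ unfolding last_max_def eq by (auto simp: I_def J_def)
qed

lemma St_disc_0_eq_St:
  "St_disc (map_poly to_fract h) (to_fract x) 0 = St (map_poly to_fract h)"
proof (cases "h = 0")
  \<comment> \<open>The translate of 0 is 0, so both sides are the same unspecified
    \<open>St 0\<close>.\<close>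
  case True
  then show ?thesis by (simp add: St_disc_def)
next
  case False
  then obtain m where m: "last_max (poly.coeff h) m" using last_max_exists by blast
  have "map_poly to_fract (h \<circ>\<^sub>p [:x, 1:]) = map_poly to_fract h \<circ>\<^sub>p [:to_fract x, 1:]"
    by (simp add: to_fract_hom.map_poly_pcompose)
  then show ?thesis
    using St_eq_last_max[OF m] St_eq_last_max[OF last_max_translate[OF m, of x]]
    by (simp add: St_disc_def)
qed

section \<open>Haar measure of the residue classes\<close>

lemma residue_plus:
  "residue (x + y :: 'p::prime_card zp) n = (residue x n + residue y n) mod int CARD('p) ^ n"
  by (simp add: plus_zp.rep_eq)

lemma residue_of_nat: "residue (of_nat a :: 'p::prime_card zp) n = int a mod int CARD('p) ^ n"
  by (induction a) (simp_all add: zero_zp.rep_eq one_zp.rep_eq residue_plus mod_simps)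

lemma residue_eq_iff_dist:
  "residue (y :: 'p::prime_card zp) n = residue z n \<longleftrightarrow> dist y z \<le> (1 / real CARD('p)) ^ n"
proof -
  have "residue (y - z) n = 0 \<longleftrightarrow> residue y n mod int CARD('p) ^ n = residue z n mod int CARD('p) ^ n"
    by (simp add: residue_minus mod_eq_dvd_iff dvd_eq_mod_eq_0 del: residue_mod)
  then show ?thesis unfolding dist_zp_def zp_abs_le_iff by simp
qed

text \<open>In an ultrametric every point of a ball is a centre of it, and residue classes modulo
  p^n are balls of radius p^(-n).\<close>

lemma open_residue_class: "open {y :: 'p::prime_card zp. residue y n = a}"
  unfolding open_dist
proof
  fix y :: "'p zp" assume y: "y \<in> {y. residue y n = a}"
  have "0 < (1 / real CARD('p)) ^ n"
    using prime_gt_1_nat[OF prime_card[where 'a='p]] by auto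
  moreover have "z \<in> {y. residue y n = a}" if "dist z y < (1 / real CARD('p)) ^ n" for z
    using that y residue_eq_iff_dist[of z n y] by simp
  ultimately show "\<exists>e>0. \<forall>z. dist z y < e \<longrightarrow> z \<in> {y. residue y n = a}" by blast
qed

lemma measurable_residue [measurable]:
  "(\<lambda>y :: 'p::prime_card zp. residue y n) \<in> borel \<rightarrow>\<^sub>M count_space UNIV"
proof (rule measurable_count_space_eq2_countable[THEN iffD2, rule_format])
  show "(\<lambda>y :: 'p zp. residue y n) \<in> space borel \<rightarrow> UNIV \<and>
      (\<forall>a\<in>UNIV. (\<lambda>y. residue y n) -` {a} \<inter> space borel \<in> sets (borel :: 'p zp measure))"
    using open_residue_class[of n] by (auto simp: vimage_def intro!: borel_open)
qed

lemma borel_measurable_translate_zp: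
  "(\<lambda>y. a + y) \<in> borel_measurable (borel :: 'p::prime_card zp measure)"
proof (rule borel_measurable_continuous_onI)
  have "dist (a + y) (a + z) = dist y z" for y z :: "'p zp"
    by (simp add: dist_zp_def)
  then show "continuous_on UNIV ((+) a)"
    by (auto simp: continuous_on_iff)
qed

text \<open>The p^n residue classes partition the space and are translates of each other, so by
  invariance they share the total mass 1 equally.\<close>

lemma haar_zp_residue_class:
  assumes "haar_zp (\<mu> :: 'p::prime_card zp measure)"
  shows "measure \<mu> {y. residue y n = 0} = (1 / real CARD('p)) ^ n"
proof -
  interpret prob_space \<mu> using assms unfolding haar_zp_def by blast
  have sets: "sets \<mu> = sets borel" and inv: "distr \<mu> borel (\<lambda>y. c + y) = \<mu>" for c
    using assms unfolding haar_zp_def by blast+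
  have space: "space \<mu> = UNIV" using sets_eq_imp_space_eq[OF sets] by simp
  define R where "R a = {y :: 'p zp. residue y n = int a}" for a
  define Q where "Q = CARD('p) ^ n"
  have Q: "0 < Q" "int CARD('p) ^ n = int Q"
    by (simp_all add: Q_def prime_gt_0_nat[OF prime_card])
  have R: "R a \<in> sets borel" for a
    unfolding R_def by (rule borel_open[OF open_residue_class])
  have eq: "measure \<mu> (R a) = measure \<mu> (R 0)" if "a < Q" for a
  proof -
    \<comment> \<open>Translation by the integer a carries the class of 0 to the class of a; a < p^n
      makes a its own residue.\<close>
    have *: "residue (of_nat a + y) n = int a \<longleftrightarrow> residue y n = 0" for y :: "'p zp"
    proof -
      have "residue (of_nat a + y) n = (int a + residue y n) mod int Q"
        unfolding residue_plus residue_of_nat Q(2) by (rule mod_add_left_eq)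
      moreover have "int a = int a mod int Q" using that by simp
      ultimately have "residue (of_nat a + y) n = int a \<longleftrightarrow> int Q dvd residue y n"
        using mod_eq_dvd_iff[of "int a + residue y n" "int Q" "int a"] by simp
      also have "\<dots> \<longleftrightarrow> residue y n = 0"
        using residue_mod[of y n] unfolding dvd_eq_mod_eq_0 Q(2) by simp
      finally show ?thesis .
    qed
    have "measure \<mu> (R a) = measure (distr \<mu> borel (\<lambda>y. of_nat a + y)) (R a)"
      unfolding inv ..
    also have "\<dots> = measure \<mu> ((\<lambda>y. of_nat a + y) -` R a \<inter> space \<mu>)"
      using borel_measurable_translate_zp measurable_cong_sets[OF sets refl]
      by (intro measure_distr R) blast
    also have "(\<lambda>y. of_nat a + y) -` R a \<inter> space \<mu> = R 0"
      unfolding R_def space by (auto simp: *)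
    finally show ?thesis .
  qed
  have "y \<in> R (nat (residue y n)) \<and> nat (residue y n) < Q" for y :: "'p zp"
    using residue_range[of y n] by (simp add: R_def nat_less_iff Q(2))
  then have "(\<Union>a<Q. R a) = space \<mu>"
    unfolding space by blast
  then have "1 = measure \<mu> (\<Union>a<Q. R a)" by (simp only: prob_space)
  also have "\<dots> = (\<Sum>a<Q. measure \<mu> (R a))"
    by (rule finite_measure_finite_Union)
      (use R in \<open>auto simp: sets disjoint_family_on_def R_def\<close>)
  also have "\<dots> = (\<Sum>a<Q. measure \<mu> (R 0))"
    by (intro sum.cong refl eq) simp
  also have "\<dots> = real Q * measure \<mu> (R 0)" by simp
  finally have "measure \<mu> (R 0) = 1 / real Q"
    using Q(1) by (simp add: field_simps)
  then show ?thesis by (simp add: R_def Q_def power_one_over)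
qed

section \<open>Distribution of the last maximum\<close>

text \<open>The range allowed to coefficient k when the last maximum is at l with absolute value
  p^(-n): at most p^(-n) before l, exactly p^(-n) at l, smaller after l.\<close>

definition last_max_cell :: "nat \<Rightarrow> nat \<Rightarrow> nat \<Rightarrow> 'p::prime_card zp set" where
  "last_max_cell n l k = {y. if k < l then residue y n = 0
     else if k = l then residue y n = 0 \<and> residue y (Suc n) \<noteq> 0
     else residue y (Suc n) = 0}"

lemma residue_0_Suc_neq_0_iff:
  "residue (y :: 'p::prime_card zp) n = 0 \<and> residue y (Suc n) \<noteq> 0 \<longleftrightarrow> y \<noteq> 0 \<and> zp_val y = n"
proof (cases "y = 0")
  case False
  then show ?thesis using le_zp_val_iff[OF False, of n] le_zp_val_iff[OF False, of "Suc n"] by auto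
qed (simp add: zero_zp.rep_eq)

text \<open>Once the valuation n of \<open>a l\<close> is fixed, all comparisons become conditions
  on single coefficients. This prepares the use of independence.\<close>

lemma last_max_iff_cell:
  assumes "l \<le> d" "\<And>k. d < k \<Longrightarrow> a k = 0"
  shows "last_max a l \<longleftrightarrow> (\<exists>n. \<forall>k\<le>d. a k \<in> last_max_cell n l k)"
proof
  assume m: "last_max a l"
  then have nz: "a l \<noteq> 0" by (simp add: last_max_def)
  have "a k \<in> last_max_cell (zp_val (a l)) l k" for k
    using m residue_0_Suc_neq_0_iff[of "a l" "zp_val (a l)"] nz
    by (auto simp: last_max_def last_max_cell_def zp_abs_less_iff zp_abs_le_zp_abs_iff)
  then show "\<exists>n. \<forall>k\<le>d. a k \<in> last_max_cell n l k" by blast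
next
  assume "\<exists>n. \<forall>k\<le>d. a k \<in> last_max_cell n l k"
  then obtain n where n: "\<And>k. k \<le> d \<Longrightarrow> a k \<in> last_max_cell n l k" by blast
  then have l: "a l \<noteq> 0" "zp_val (a l) = n"
    using assms(1) residue_0_Suc_neq_0_iff[of "a l" n] n[of l] by (auto simp: last_max_cell_def)
  have "residue (a k) (Suc n) = 0" if "l < k" for k
    using n[of k] that assms(2)[of k]
    by (cases "k \<le> d") (auto simp: last_max_cell_def zero_zp.rep_eq)
  moreover have "residue (a k) n = 0" if "k < l" for k
    using n[of k] that assms(1) by (auto simp: last_max_cell_def)
  ultimately show "last_max a l"
    using l by (auto simp: last_max_def zp_abs_less_iff zp_abs_le_zp_abs_iff)
qed

lemma sets_last_max_cell [measurable]: "last_max_cell n l k \<in> sets borel"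
  unfolding last_max_cell_def by measurable

lemma haar_zp_last_max_cell:
  assumes "haar_zp (\<mu> :: 'p::prime_card zp measure)"
  shows "measure \<mu> (last_max_cell n l k) =
    (let q = 1 / real CARD('p) in
     if k < l then q ^ n else if k = l then q ^ n - q ^ Suc n else q ^ Suc n)"
proof -
  interpret prob_space \<mu> using assms unfolding haar_zp_def by blast
  have sets: "sets \<mu> = sets borel" using assms by (simp add: haar_zp_def)
  \<comment> \<open>The cell at k = l is a difference of two nested residue classes.\<close>
  have "measure \<mu> {y. residue y n = 0 \<and> residue y (Suc n) \<noteq> 0}
      = measure \<mu> ({y. residue y n = 0} - {y. residue y (Suc n) = 0})"
    by (rule arg_cong[where f="measure \<mu>"]) auto
  also have "\<dots> = measure \<mu> {y. residue y n = 0} - measure \<mu> {y. residue y (Suc n) = 0}"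
    by (rule finite_measure_Diff)
      (auto simp: sets open_residue_class intro: residue_eq_0_mono[of n "Suc n"])
  finally show ?thesis
    by (simp add: last_max_cell_def haar_zp_residue_class[OF assms] Let_def del: power_Suc)
qed

section \<open>Closed forms for the product and the sum that occur below\<close>

lemma prod_three_cases:
  fixes a b c :: "'a::comm_monoid_mult"
  assumes "l \<le> d"
  shows "(\<Prod>k\<le>d. if k < l then a else if k = l then b else c) = a ^ l * b * c ^ (d - l)"
proof -
  let ?g = "\<lambda>k. if k < l then a else if k = l then b else c"
  have "{..d} = {..<l} \<union> {l..d}" using assms by auto
  then have "prod ?g {..d} = prod ?g {..<l} * prod ?g {l..d}"
    by (simp only:) (rule prod.union_disjoint, auto)
  also have "prod ?g {l..d} = b * prod ?g {l<..d}"
    using assms by (simp add: prod.head)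
  finally have "prod ?g {..d} = (\<Prod>k<l. a) * (b * (\<Prod>k\<in>{l<..d}. c))"
    by simp
  then show ?thesis by (simp add: mult.assoc)
qed

lemma sum_of_nat_mult_power:
  fixes p :: "'a::field"
  assumes "p \<noteq> 1"
  shows "(\<Sum>l\<le>d. of_nat l * p ^ l)
    = (of_nat d * p ^ (d + 2) - of_nat (d + 1) * p ^ (d + 1) + p) / (p - 1) ^ 2"
proof (induction d)
  case (Suc d)
  have "p - 1 \<noteq> 0" using assms by simp
  then show ?case unfolding sum.atMost_Suc Suc.IH
    by (simp add: divide_simps) (simp add: algebra_simps power2_eq_square)
qed simp

section \<open>Independent Haar-distributed coefficients\<close>

locale random_padic_coeffs = prob_space M for M :: "'w measure" +
  fixes d :: nat and X :: "nat \<Rightarrow> 'w \<Rightarrow> 'p::prime_card zp"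
  assumes indep: "indep_vars (\<lambda>_. borel) X {..d}"
    and haar: "\<And>k. k \<le> d \<Longrightarrow> haar_zp (distr M borel (X k))"
begin

definition coeffs_at :: "'w \<Rightarrow> nat \<Rightarrow> 'p zp" where
  "coeffs_at \<omega> k = (if k \<le> d then X k \<omega> else 0)"

definition level :: "nat \<Rightarrow> nat \<Rightarrow> 'w set" where
  "level l n = (\<Inter>k\<le>d. X k -` last_max_cell n l k \<inter> space M)"

definition last_max_event :: "nat \<Rightarrow> 'w set" where
  "last_max_event l = {\<omega> \<in> space M. last_max (coeffs_at \<omega>) l}"

lemma X_measurable: "k \<le> d \<Longrightarrow> X k \<in> borel_measurable M"
  using indep by (auto simp: indep_vars_def)

lemma sets_level: "level l n \<in> events"
  unfolding level_def
  by (intro sets.finite_INT measurable_sets[OF X_measurable]) auto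

lemma last_max_event_eq: "l \<le> d \<Longrightarrow> last_max_event l = (\<Union>n. level l n)"
  unfolding last_max_event_def level_def
  by (subst last_max_iff_cell[where d=d]) (auto simp: coeffs_at_def)

lemma sets_last_max_event: "l \<le> d \<Longrightarrow> last_max_event l \<in> events"
  using sets_level by (simp add: last_max_event_eq)

lemma prob_X_cell:
  assumes "k \<le> d" "A \<in> sets borel"
  shows "prob (X k -` A \<inter> space M) = measure (distr M borel (X k)) A"
  using assms by (simp add: measure_distr X_measurable)

lemma prob_level:
  fixes q defines "q \<equiv> 1 / real CARD('p)"
  assumes "l \<le> d"
  shows "prob (level l n) = (1 - q) * q ^ (d - l) * (q ^ (d + 1)) ^ n"
proof -
  have "prob (level l n) = (\<Prod>k\<le>d. prob (X k -` last_max_cell n l k \<inter> space M))"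
    unfolding level_def by (rule indep_varsD[OF indep]) auto
  also have "\<dots> = (\<Prod>k\<le>d. if k < l then q ^ n else if k = l then q ^ n - q ^ Suc n else q ^ Suc n)"
    by (intro prod.cong refl) (simp add: prob_X_cell haar_zp_last_max_cell haar Let_def q_def)
  also have "\<dots> = (q ^ n) ^ l * (q ^ n - q ^ Suc n) * (q ^ Suc n) ^ (d - l)"
    by (rule prod_three_cases[OF assms(2)])
  \<comment> \<open>Each of the d + 1 coefficients contributes one factor q^n; what remains does not
    depend on n.\<close>
  also have "\<dots> = (1 - q) * q ^ (d - l) * ((q ^ n) ^ l * q ^ n * (q ^ n) ^ (d - l))"
    by (simp add: power_mult_distrib algebra_simps)
  also have "(q ^ n) ^ l * q ^ n * (q ^ n) ^ (d - l) = (q ^ n) ^ (l + 1 + (d - l))"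
    by (simp add: power_add)
  also have "\<dots> = (q ^ (d + 1)) ^ n"
    using assms(2) by (simp only: flip: power_mult) (simp add: mult.commute)
  finally show ?thesis .
qed

text \<open>The levels are disjoint because n is the valuation of \<open>X l\<close>, so their
  probabilities add up to a geometric series of ratio q^(d+1).\<close>

lemma prob_last_max_event:
  fixes q defines "q \<equiv> 1 / real CARD('p)"
  assumes "l \<le> d"
  shows "prob (last_max_event l) = (1 - q) / (1 - q ^ (d + 1)) * q ^ (d - l)"
proof -
  have q: "0 < q" "q < 1" using prime_gt_1_nat[OF prime_card[where 'a='p]] by (auto simp: q_def)
  have "disjoint_family (level l)"
    unfolding disjoint_family_on_def
  proof (intro ballI impI)
    fix m n :: nat assume "m \<noteq> n"
    have "zp_val (X l \<omega>) = n" if "\<omega> \<in> level l n" for \<omega> n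
      using that assms(2) residue_0_Suc_neq_0_iff[of "X l \<omega>" n]
      by (force simp: level_def last_max_cell_def)
    then show "level l m \<inter> level l n = {}" using \<open>m \<noteq> n\<close> by blast
  qed
  then have "(\<lambda>n. prob (level l n)) sums prob (last_max_event l)"
    unfolding last_max_event_eq[OF assms(2)]
    using sets_level by (intro finite_measure_UNION) auto
  moreover have "(\<lambda>n. prob (level l n)) sums ((1 - q) * q ^ (d - l) * (1 / (1 - q ^ (d + 1))))"
    unfolding prob_level[OF assms(2), folded q_def]
    using q by (intro sums_mult geometric_sums) (simp add: power_Suc_less_one del: power_Suc)
  ultimately show ?thesis by (simp add: sums_iff)
qed

text \<open>The point 0 lies in the zero class modulo p^n for every n, and these classes have
  probability q^n, which tends to 0. This makes the zero polynomial a null event.\<close>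

lemma AE_X_0_neq_0: "AE \<omega> in M. X 0 \<omega> \<noteq> 0"
proof -
  define q where "q = 1 / real CARD('p)"
  have q: "0 < q" "q < 1" using prime_gt_1_nat[OF prime_card[where 'a='p]] by (auto simp: q_def)
  let ?Z = "X 0 -` {0} \<inter> space M"
  have Z: "?Z \<in> events" by (rule measurable_sets[OF X_measurable]) auto
  have "prob ?Z \<le> q ^ n" for n
  proof -
    have "prob ?Z \<le> prob (X 0 -` {y. residue y n = 0} \<inter> space M)"
      by (intro finite_measure_mono measurable_sets[OF X_measurable])
        (auto simp: zero_zp.rep_eq open_residue_class)
    also have "\<dots> = q ^ n"
      by (subst prob_X_cell) (auto simp: open_residue_class haar haar_zp_residue_class q_def)
    finally show ?thesis .
  qed
  then have "prob ?Z \<le> 0"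
    using LIMSEQ_le_const[OF LIMSEQ_realpow_zero[of q]] q by auto
  then have "prob ?Z = 0" by (simp add: measure_le_0_iff)
  then have "?Z \<in> null_sets M" using Z by (intro null_setsI) (simp_all add: emeasure_eq_measure)
  then show ?thesis by (rule AE_I') auto
qed

end

section \<open>The law and the mean of \<open>St_disc\<close>\<close>

theorem theorem4p9:
  fixes M :: "'w measure" and f :: "'w \<Rightarrow> 'p::prime_card zp poly" and x :: "'p zp"
    and d :: nat and p :: real
  assumes "p = real CARD('p)"
    and "random_padic_poly M d f"
  shows "(\<forall>l\<in>{0..d}.
      measure M {\<omega> \<in> space M. St_disc (map_poly to_fract (f \<omega>)) (to_fract x) 0 = l}
        = (1 - p powi (- 1)) / (1 - p powi (- (int d + 1))) * p powi (int l - int d)) \<and>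
    (\<integral>\<omega>. real (St_disc (map_poly to_fract (f \<omega>)) (to_fract x) 0) \<partial>M)
        = real d + (real d + 1) / (p ^ (d + 1) - 1) - 1 / (p - 1)"
proof -
  obtain X :: "nat \<Rightarrow> 'w \<Rightarrow> 'p zp" where
    X: "random_padic_coeffs M d X" and
    f: "\<And>\<omega>. \<omega> \<in> space M \<Longrightarrow> f \<omega> = (\<Sum>k\<le>d. Polynomial.monom (X k \<omega>) k)"
    using assms(2) unfolding random_padic_poly_def random_padic_coeffs_def
      random_padic_coeffs_axioms_def by blast
  interpret random_padic_coeffs M d X by (fact X)
  have p: "1 < p" using prime_gt_1_nat[OF prime_card[where 'a='p]] by (simp add: assms(1))
  define S where "S \<omega> = St_disc (map_poly to_fract (f \<omega>)) (to_fract x) 0" for \<omega>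
  have coeff: "poly.coeff (f \<omega>) = coeffs_at \<omega>" if "\<omega> \<in> space M" for \<omega>
    using f[OF that] by (simp add: fun_eq_iff coeff_sum coeffs_at_def)
  have S: "S \<omega> = l" if "\<omega> \<in> last_max_event l" for \<omega> l
    using that coeff St_eq_last_max[of "f \<omega>" l]
    by (auto simp: S_def St_disc_0_eq_St last_max_event_def)
  have f_0: "f \<omega> = 0 \<longleftrightarrow> \<omega> \<notin> (\<Union>l\<le>d. last_max_event l)" if "\<omega> \<in> space M" for \<omega>
  proof (cases "f \<omega> = 0")
    case True
    then have "coeffs_at \<omega> k = 0" for k using coeff[OF that] by (metis coeff_0)
    then show ?thesis using True by (simp add: last_max_event_def last_max_def)
  next
    case False
    have "degree (f \<omega>) \<le> d"
      by (rule degree_le) (simp add: coeff[OF that] coeffs_at_def)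
    then have "\<exists>l\<le>d. last_max (coeffs_at \<omega>) l"
      using last_max_exists[OF False] coeff[OF that] le_trans by metis
    then show ?thesis using False that by (auto simp: last_max_event_def)
  qed
  \<comment> \<open>\<open>St 0\<close> is an unspecified number, so the zero polynomial may belong to any fibre of \<open>S\<close>.\<close>
  have fibre: "{\<omega> \<in> space M. S \<omega> = l} = (if l \<le> d then last_max_event l else {}) \<union>
      (if St (0 :: 'p qp poly) = l then space M - (\<Union>l\<le>d. last_max_event l) else {})" for l
  proof -
    have "S \<omega> = l \<longleftrightarrow> \<omega> \<in> (if l \<le> d then last_max_event l else {}) \<union>
      (if St (0 :: 'p qp poly) = l then space M - (\<Union>l\<le>d. last_max_event l) else {})"
      if \<omega>: "\<omega> \<in> space M" for \<omega>
    proof (cases "f \<omega> = 0")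
      case True
      then have "S \<omega> = St (0 :: 'p qp poly)" unfolding S_def St_disc_0_eq_St by simp
      then show ?thesis using f_0[OF \<omega>] True \<omega> by auto
    next
      case False
      then obtain m where "m \<le> d" "\<omega> \<in> last_max_event m" using f_0[OF \<omega>] by auto
      then show ?thesis using S by auto
    qed
    moreover have "(if l \<le> d then last_max_event l else {}) \<union>
      (if St (0 :: 'p qp poly) = l then space M - (\<Union>l\<le>d. last_max_event l) else {}) \<subseteq> space M"
      by (auto simp: last_max_event_def)
    ultimately show ?thesis by blast
  qed
  have [measurable]: "S \<in> M \<rightarrow>\<^sub>M count_space UNIV"
  proof (rule measurable_count_space_eq2_countable[THEN iffD2])
    have "{\<omega> \<in> space M. S \<omega> = l} \<in> events" for l
      unfolding fibre using sets_last_max_event by auto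
    moreover have "S -` {l} \<inter> space M = {\<omega> \<in> space M. S \<omega> = l}" for l by auto
    ultimately show "S \<in> space M \<rightarrow> UNIV \<and> (\<forall>l\<in>UNIV. S -` {l} \<inter> space M \<in> events)" by simp
  qed
  have AE_f: "AE \<omega> in M. f \<omega> \<noteq> 0"
    using AE_X_0_neq_0 AE_space
  proof eventually_elim
    case (elim \<omega>)
    then have "poly.coeff (f \<omega>) 0 \<noteq> 0" by (simp add: coeff coeffs_at_def)
    then show ?case by auto
  qed
  \<comment> \<open>The two events differ at most on the null event f = 0.\<close>
  have prob_S: "prob {\<omega> \<in> space M. S \<omega> = l} = prob (last_max_event l)" if "l \<le> d" for l
  proof (rule measure_eq_AE)
    show "AE \<omega> in M. \<omega> \<in> {\<omega> \<in> space M. S \<omega> = l} \<longleftrightarrow> \<omega> \<in> last_max_event l"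
      using AE_f AE_space by eventually_elim (use f_0 that fibre in auto)
  qed (use sets_last_max_event that in auto)
  \<comment> \<open>Numerator and denominator are multiplied by p^(d+1), which removes the negative
    powers before summation.\<close>
  have prob_l: "prob (last_max_event l) = (p - 1) * p ^ l / (p ^ (d + 1) - 1)" if "l \<le> d" for l
  proof -
    have "p ^ d = p ^ l * p ^ (d - l)" using that by (simp flip: power_add)
    moreover have "p ^ d * p \<noteq> 1" using one_less_power[OF p, of "d + 1"] by (simp add: mult.commute)
    ultimately show ?thesis
      using p prob_last_max_event[OF that]
      by (simp add: flip: assms(1)) (simp add: field_simps power_one_over)
  qed
  have formula: "(p - 1) * p ^ l / (p ^ (d + 1) - 1) =
      (1 - p powi (- 1)) / (1 - p powi (- (int d + 1))) * p powi (int l - int d)" for l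
  proof -
    have "p powi (- (int d + 1)) = p powi (- int (d + 1))"
      by (rule arg_cong[where f="\<lambda>k. p powi k"]) simp
    also have "\<dots> = 1 / p ^ (d + 1)"
      unfolding power_int_minus power_int_of_nat by (simp add: divide_inverse)
    finally have e1: "p powi (- (int d + 1)) = 1 / p ^ (d + 1)" .
    have e2: "p powi (int l - int d) = p ^ l / p ^ d" using p by (simp add: power_int_diff)
    have e3: "p powi (- 1) = 1 / p" by (simp add: power_int_minus divide_inverse)
    have "p ^ d * p \<noteq> 1" using one_less_power[OF p, of "d + 1"] by (simp add: mult.commute)
    then show ?thesis unfolding e1 e2 e3 using p by (simp add: field_simps)
  qed
  have AE_S: "AE \<omega> in M. real (S \<omega>) = (\<Sum>l\<le>d. real l * indicator (last_max_event l) \<omega>)"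
    using AE_f AE_space
  proof eventually_elim
    case (elim \<omega>)
    then obtain m where m: "m \<le> d" "\<omega> \<in> last_max_event m" using f_0 by auto
    \<comment> \<open>Membership in \<open>last_max_event l\<close> forces
      \<open>S \<omega> = l\<close>, so only the event with index m contains this outcome.\<close>
    then have "real l * indicator (last_max_event l) \<omega> = (if l = m then real l else 0)" for l
      using S by (auto simp: indicator_def)
    then have "(\<Sum>l\<le>d. real l * indicator (last_max_event l) \<omega>) = (\<Sum>l\<le>d. if l = m then real l else 0)"
      by (intro sum.cong refl)
    also have "\<dots> = real (S \<omega>)"
      using m S by simp
    finally show ?case ..
  qed
  have "(\<integral>\<omega>. real (S \<omega>) \<partial>M) = (\<integral>\<omega>. (\<Sum>l\<le>d. real l * indicator (last_max_event l) \<omega>) \<partial>M)"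
  proof (intro integral_cong_AE AE_S)
    show "(\<lambda>\<omega>. real (S \<omega>)) \<in> borel_measurable M" by measurable
    show "(\<lambda>\<omega>. \<Sum>l\<le>d. real l * indicator (last_max_event l) \<omega>) \<in> borel_measurable M"
      using sets_last_max_event
      by (intro borel_measurable_sum borel_measurable_times borel_measurable_indicator) simp_all
  qed
  also have "\<dots> = (\<Sum>l\<le>d. \<integral>\<omega>. real l * indicator (last_max_event l) \<omega> \<partial>M)"
    using sets_last_max_event
    by (intro Bochner_Integration.integral_sum integrable_mult_right integrable_real_indicator)
      (simp_all add: less_top[symmetric])
  also have "\<dots> = (\<Sum>l\<le>d. real l * prob (last_max_event l))"
    using sets_last_max_event by (intro sum.cong refl) simp
  also have "\<dots> = (p - 1) / (p ^ (d + 1) - 1) * (\<Sum>l\<le>d. real l * p ^ l)"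
    unfolding sum_distrib_left by (intro sum.cong refl) (simp add: prob_l)
  also have "\<dots> = real d + (real d + 1) / (p ^ (d + 1) - 1) - 1 / (p - 1)"
  proof -
    \<comment> \<open>Both sides are rational in p, d and \<open>D\<close>; with \<open>D\<close> as
      a variable of its own the identity follows by clearing denominators.\<close>
    define D where "D = p ^ (d + 1) - 1"
    have D: "D > 0" "p ^ (d + 1) = D + 1" "p ^ (d + 2) = p * (D + 1)"
      using one_less_power[OF p, of "d + 1"] by (auto simp: D_def)
    have p1: "p - 1 > 0" using p by simp
    have sum: "(\<Sum>l\<le>d. real l * p ^ l)
        = (real d * (p * (D + 1)) - (real d + 1) * (D + 1) + p) / (p - 1)\<^sup>2"
      using sum_of_nat_mult_power[of p d] p unfolding D by (simp add: add.commute)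
    have "(p - 1) / D * (\<Sum>l\<le>d. real l * p ^ l)
        = (real d * (p * (D + 1)) - (real d + 1) * (D + 1) + p) / (D * (p - 1))"
      unfolding sum using p1 D(1) by (simp add: power2_eq_square)
    also have "\<dots> = real d + (real d + 1) / D - 1 / (p - 1)"
      using p1 D(1) by (simp add: divide_simps) (simp add: algebra_simps)
    finally show ?thesis unfolding D_def .
  qed
  finally show ?thesis
    using prob_S prob_l formula unfolding S_def by auto
qed

end
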